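(* Let $I=[a,b]$ with $-\infty<a<b<\infty$, and let $\{\omega_{s,t}\}_{(s,t)\in I_+^2}$ be an evolution family on $I$. Then the following are equivalent: (i) the family $\{\omega_{s,t}\}_{(s,t)\in I_+^2}$ is jointly continuous; (ii) the family $\{\omega_{s,t}\}_{(s,t)\in I_+^2}$ is continuous with respect to the right parameter; (iii) for each fixed $z_0\in\mathbb{D}$, $\omega_{a,t}(z_0)$ and $\omega_{a,t}'(z_0)$ are continuous functions of $t\in[a,b]$; (iv) for some $z_0\in\mathbb{D}$, $\omega_{a,t}(z_0)$ and $\omega_{a,t}'(z_0)$ are continuous functions of $t\in[a,b]$. Furthermore, in these cases $\omega_{s,t}$ is univalent (injective) on $\mathbb{D}$ for each $(s,t)\in I_+^2$.
   Context: $\mathbb{D}=\{z\in\mathbb{C}:|z|<1\}$. $\mathcal{A}$ is the space of all analytic functions $f:\mathbb{D}\to\mathbb{C}$ with the topology of locally uniform convergence on $\mathbb{D}$, and $\mathfrak{B}=\{f\in\mathcal{A}: f(\mathbb{D})\subset\mathbb{D}\}$. For an interval $I$, $I_+^2=\{(s,t): s,t\in I,\ s\le t\}$. A prime denotes the derivative with respect to $z$. Evolution family: a family $\{\omega_{s,t}\}_{(s,t)\in I_+^2}$ in $\mathfrak{B}$ is an evolution family (on $I$) if (EF1) $\omega_{s,t}$ is non-constant for all $(s,t)\in I_+^2$; (EF2) $\omega_{t,t}=\mathrm{id}_{\mathbb{D}}$ for all $t\in I$; (EF3) $\omega_{u,t}\circ\omega_{s,u}=\omega_{s,t}$ for all $s,u,t\in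 I$ with $s\le u\le t$. Jointly continuous: the mapping $I_+^2\ni(s,t)\mapsto\omega_{s,t}\in\mathcal{A}$ is continuous. Continuous with respect to the right parameter (for $I=[a,b]$): the mapping $I\ni t\mapsto\omega_{a,t}\in\mathcal{A}$ is continuous. *)

theory Defs
  imports "HOL-Complex_Analysis.Complex_Analysis"
begin

abbreviation unit_disc :: "complex set" where
  "unit_disc \<equiv> ball 0 1"

text \<open>Functions on the disc are total functions of which only the values on the disc matter:
  two functions that agree there are indistinguishable in the topology below, and
  conditions such as \<open>\<omega> t t = id\<close> are required on the disc only.\<close>

definition analytic_disc :: "(complex \<Rightarrow> complex) set" where
  "analytic_disc = {f. f holomorphic_on unit_disc}"

definition self_maps_disc :: "(complex \<Rightarrow> complex) set" where
  "self_maps_disc = {f \<in> analytic_disc. f ` unit_disc \<subseteq> unit_disc}"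

text \<open>The topology of locally uniform convergence. The sets below, for compact \<open>K\<close> in the
  disc and \<open>\<epsilon> > 0\<close>, form a neighbourhood basis at \<open>f\<close>.\<close>

definition loc_unif_nbhd ::
    "(complex \<Rightarrow> complex) \<Rightarrow> complex set \<Rightarrow> real \<Rightarrow> (complex \<Rightarrow> complex) set" where
  "loc_unif_nbhd f K \<epsilon> = {g \<in> analytic_disc. \<forall>z\<in>K. dist (g z) (f z) < \<epsilon>}"

definition loc_unif_topology :: "(complex \<Rightarrow> complex) topology" where
  "loc_unif_topology = topology (\<lambda>U. U \<subseteq> analytic_disc \<and>
     (\<forall>f\<in>U. \<exists>K \<epsilon>. compact K \<and> K \<subseteq> unit_disc \<and> 0 < \<epsilon> \<and> loc_unif_nbhd f K \<epsilon> \<subseteq> U))"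

lemma openin_loc_unif_topology:
  "openin loc_unif_topology U \<longleftrightarrow> U \<subseteq> analytic_disc \<and>
     (\<forall>f\<in>U. \<exists>K \<epsilon>. compact K \<and> K \<subseteq> unit_disc \<and> 0 < \<epsilon> \<and> loc_unif_nbhd f K \<epsilon> \<subseteq> U)"
proof -
  let ?P = "\<lambda>f U. \<exists>K \<epsilon>. compact K \<and> K \<subseteq> unit_disc \<and> 0 < \<epsilon> \<and> loc_unif_nbhd f K \<epsilon> \<subseteq> U"
  have int: "?P f (S \<inter> T)" if ST: "?P f S" "?P f T" for f S T
  proof -
    obtain K d where 1: "compact K" "K \<subseteq> unit_disc" "0 < d" "loc_unif_nbhd f K d \<subseteq> S"
      using ST(1) by blast
    obtain L e where 2: "compact L" "L \<subseteq> unit_disc" "0 < e" "loc_unif_nbhd f L e \<subseteq> T"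
      using ST(2) by blast
    have "loc_unif_nbhd f (K \<union> L) (min d e) \<subseteq> S \<inter> T"
      using 1(4) 2(4) by (auto simp: loc_unif_nbhd_def)
    moreover have "compact (K \<union> L)" "K \<union> L \<subseteq> unit_disc" "0 < min d e"
      using 1 2 by auto
    ultimately show ?thesis by blast
  qed
  have mono: "?P f T" if P: "?P f S" and "S \<subseteq> T" for f S T
  proof -
    obtain K d where "compact K" "K \<subseteq> unit_disc" "0 < d" "loc_unif_nbhd f K d \<subseteq> S"
      using P by blast
    with \<open>S \<subseteq> T\<close> show ?thesis by blast
  qed
  have "istopology (\<lambda>U. U \<subseteq> analytic_disc \<and> (\<forall>f\<in>U. ?P f U))"
    unfolding istopology_def
  proof (rule conjI; intro allI impI)
    fix S T
    assume S: "S \<subseteq> analytic_disc \<and> (\<forall>f\<in>S. ?P f S)"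
      and T: "T \<subseteq> analytic_disc \<and> (\<forall>f\<in>T. ?P f T)"
    have "?P f (S \<inter> T)" if "f \<in> S \<inter> T" for f
      using that S T by (intro int) simp_all
    moreover have "S \<inter> T \<subseteq> analytic_disc"
      using S by blast
    ultimately show "S \<inter> T \<subseteq> analytic_disc \<and> (\<forall>f\<in>S \<inter> T. ?P f (S \<inter> T))"
      by simp
  next
    fix \<K>
    assume \<K>: "\<forall>S\<in>\<K>. S \<subseteq> analytic_disc \<and> (\<forall>f\<in>S. ?P f S)"
    have "?P f (\<Union>\<K>)" if f: "f \<in> \<Union>\<K>" for f
    proof -
      obtain S where S: "S \<in> \<K>" "f \<in> S" using f by blast
      with \<K> have "?P f S" by simp
      then show ?thesis by (rule mono) (use S in blast)
    qed
    moreover have "\<Union>\<K> \<subseteq> analytic_disc"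
      using \<K> by blast
    ultimately show "\<Union>\<K> \<subseteq> analytic_disc \<and> (\<forall>f\<in>\<Union>\<K>. ?P f (\<Union>\<K>))"
      by simp
  qed
  then show ?thesis
    unfolding loc_unif_topology_def by (simp add: topology_inverse')
qed

lemma topspace_loc_unif_topology [simp]: "topspace loc_unif_topology = analytic_disc"
proof
  show "topspace loc_unif_topology \<subseteq> analytic_disc"
    using openin_loc_unif_topology openin_topspace by blast
  have "openin loc_unif_topology analytic_disc"
    unfolding openin_loc_unif_topology
    by (intro conjI ballI exI[of _ "{}"] exI[of _ "1::real"]) (auto simp: loc_unif_nbhd_def)
  then show "analytic_disc \<subseteq> topspace loc_unif_topology"
    by (rule openin_subset)
qed

lemma limitin_loc_unif_topology:
  assumes "\<forall>\<^sub>F n in F. f n \<in> analytic_disc" "g \<in> analytic_disc"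
  shows "limitin loc_unif_topology f g F \<longleftrightarrow>
     (\<forall>K. compact K \<and> K \<subseteq> unit_disc \<longrightarrow> uniform_limit K f g F)"
proof
  assume lim: "limitin loc_unif_topology f g F"
  show "\<forall>K. compact K \<and> K \<subseteq> unit_disc \<longrightarrow> uniform_limit K f g F"
  proof (intro allI impI uniform_limitI)
    fix K and e :: real
    assume K: "compact K \<and> K \<subseteq> unit_disc" and "0 < e"
    define U where "U = {h \<in> analytic_disc. \<exists>d<e. \<forall>z\<in>K. dist (h z) (g z) \<le> d}"
    have "openin loc_unif_topology U"
      unfolding openin_loc_unif_topology
    proof (intro conjI ballI)
      fix h assume "h \<in> U"
      then obtain d where d: "d < e" "\<forall>z\<in>K. dist (h z) (g z) \<le> d" by (auto simp: U_def)
      have "loc_unif_nbhd h K ((e - d) / 2) \<subseteq> U"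
      proof
        fix k assume k: "k \<in> loc_unif_nbhd h K ((e - d) / 2)"
        have "dist (k z) (g z) \<le> (e + d) / 2" if "z \<in> K" for z
        proof -
          have "dist (k z) (g z) \<le> dist (k z) (h z) + dist (h z) (g z)"
            by (rule dist_triangle)
          also have "\<dots> \<le> (e - d) / 2 + d"
            using k d that by (intro add_mono) (auto simp: loc_unif_nbhd_def intro: less_imp_le)
          finally show ?thesis by (simp add: field_simps)
        qed
        then show "k \<in> U"
          using k d(1) by (auto simp: U_def loc_unif_nbhd_def intro!: exI[of _ "(e + d) / 2"])
      qed
      then show "\<exists>K \<epsilon>. compact K \<and> K \<subseteq> unit_disc \<and> 0 < \<epsilon> \<and> loc_unif_nbhd h K \<epsilon> \<subseteq> U"
        using K d(1) by (intro exI[of _ K] exI[of _ "(e - d) / 2"]) auto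
    qed (auto simp: U_def)
    moreover have "g \<in> U"
      using assms(2) \<open>0 < e\<close> by (auto simp: U_def)
    ultimately have "\<forall>\<^sub>F n in F. f n \<in> U"
      using lim by (simp add: limitin_def)
    then show "\<forall>\<^sub>F n in F. \<forall>z\<in>K. dist (f n z) (g z) < e"
      by eventually_elim (fastforce simp: U_def)
  qed
next
  assume unif: "\<forall>K. compact K \<and> K \<subseteq> unit_disc \<longrightarrow> uniform_limit K f g F"
  show "limitin loc_unif_topology f g F"
    unfolding limitin_def
  proof (intro conjI allI impI)
    fix U assume "openin loc_unif_topology U \<and> g \<in> U"
    then obtain K e where K: "compact K" "K \<subseteq> unit_disc" "0 < e" "loc_unif_nbhd g K e \<subseteq> U"
      unfolding openin_loc_unif_topology by blast
    then have "\<forall>\<^sub>F n in F. \<forall>z\<in>K. dist (f n z) (g z) < e"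
      using unif by (auto dest: uniform_limitD)
    with assms(1) show "\<forall>\<^sub>F n in F. f n \<in> U"
      by eventually_elim (use K(4) in \<open>auto simp: loc_unif_nbhd_def\<close>)
  qed (simp add: assms(2))
qed

definition ordered_pairs :: "real set \<Rightarrow> (real \<times> real) set" where
  "ordered_pairs I = {(s, t). s \<in> I \<and> t \<in> I \<and> s \<le> t}"

definition evolution_family :: "real set \<Rightarrow> (real \<Rightarrow> real \<Rightarrow> complex \<Rightarrow> complex) \<Rightarrow> bool" where
  "evolution_family I \<omega> \<longleftrightarrow>
     (\<forall>(s, t)\<in>ordered_pairs I. \<omega> s t \<in> self_maps_disc) \<and>
     (\<forall>(s, t)\<in>ordered_pairs I. \<not> \<omega> s t constant_on unit_disc) \<and>
     (\<forall>t\<in>I. \<forall>z\<in>unit_disc. \<omega> t t z = z) \<and>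
     (\<forall>s\<in>I. \<forall>u\<in>I. \<forall>t\<in>I. s \<le> u \<and> u \<le> t \<longrightarrow>
        (\<forall>z\<in>unit_disc. (\<omega> u t \<circ> \<omega> s u) z = \<omega> s t z))"

definition jointly_continuous ::
    "real set \<Rightarrow> (real \<Rightarrow> real \<Rightarrow> complex \<Rightarrow> complex) \<Rightarrow> bool" where
  "jointly_continuous I \<omega> \<longleftrightarrow>
     continuous_map (top_of_set (ordered_pairs I)) loc_unif_topology (\<lambda>(s, t). \<omega> s t)"

definition continuous_right_parameter ::
    "real \<Rightarrow> real \<Rightarrow> (real \<Rightarrow> real \<Rightarrow> complex \<Rightarrow> complex) \<Rightarrow> bool" where
  "continuous_right_parameter a b \<omega> \<longleftrightarrow>
     continuous_map (top_of_set {a..b}) loc_unif_topology (\<lambda>t. \<omega> a t)"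

end

theory Submission
  imports Defs
begin

text \<open>
  The implication that carries the theorem starts from one base point \<open>z0\<close> at which
  \<open>\<omega> a t z0\<close> and the derivative of \<open>\<omega> a t\<close> at \<open>z0\<close> depend continuously on
  \<open>t\<close>, and ends with continuity of \<open>t \<mapsto> \<omega> a t\<close> in the space of analytic functions.
  Self-maps of the disc form a normal family, so every convergence question can be decided by
  identifying subsequential limits. If \<open>s n \<le> t n\<close> both tend to \<open>u\<close>, the semigroup law
  becomes \<open>h = k \<circ> g\<close> for limits of \<open>\<omega> a (t n)\<close>, \<open>\<omega> (s n) (t n)\<close> and
  \<open>\<omega> a (s n)\<close> (lemma \<open>evolution_subsequential_limits\<close>). The data at \<open>z0\<close> show that
  \<open>k\<close> has a fixed point in the disc, and that its derivative there is \<open>1\<close> provided the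
  derivative of \<open>\<omega> a u\<close> at \<open>z0\<close> is not zero. By the Schwarz lemma \<open>k\<close> is then the
  identity, which is continuity at \<open>u\<close> (lemma \<open>evolution_continuous_at_regular_time\<close>).

  It remains to see that this derivative never vanishes (lemma \<open>evolution_deriv_nonzero\<close>). The
  argument uses the other conclusions of the theorem on shorter intervals. Before a first zero
  \<open>u\<close> the family is continuous in the right parameter, hence jointly continuous by the identity
  theorem, hence univalent: two trajectories cannot meet for a first time, because the maps
  \<open>\<omega> v u\<close> are injective near the meeting point for \<open>v\<close> close to \<open>u\<close>. A limit of the
  univalent maps \<open>\<omega> a v\<close> as \<open>v\<close> increases to \<open>u\<close> has derivative zero at
  \<open>z0\<close>, so it is constant by Hurwitz's theorem, and then \<open>\<omega> a u\<close> would be constant too.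

  The remaining implications follow because locally uniform convergence of analytic functions implies
  convergence of values and derivatives.
\<close>

section \<open>Locally uniform convergence of sequences on the disc\<close>

definition locally_uniform_limit ::
    "(nat \<Rightarrow> complex \<Rightarrow> complex) \<Rightarrow> (complex \<Rightarrow> complex) \<Rightarrow> bool" where
  "locally_uniform_limit f g \<longleftrightarrow>
     (\<forall>K. compact K \<and> K \<subseteq> unit_disc \<longrightarrow> uniform_limit K f g sequentially)"

lemma locally_uniform_limit_subseq:
  assumes "locally_uniform_limit f g" "strict_mono r"
  shows "locally_uniform_limit (\<lambda>n. f (r n)) g"
  unfolding locally_uniform_limit_def
proof (intro allI impI)
  fix K :: "complex set" assume "compact K \<and> K \<subseteq> unit_disc"
  then have "uniform_limit K f g sequentially"
    using assms(1) by (simp add: locally_uniform_limit_def)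
  then show "uniform_limit K (\<lambda>n. f (r n)) g sequentially"
    using filterlim_compose filterlim_subseq[OF assms(2)] by blast
qed

lemma locally_uniform_limit_cball:
  assumes "locally_uniform_limit f g" "z \<in> unit_disc"
  obtains d where "0 < d" "cball z d \<subseteq> unit_disc" "uniform_limit (cball z d) f g sequentially"
proof -
  obtain d where d: "0 < d" "cball z d \<subseteq> unit_disc"
    using assms(2) open_contains_cball[of unit_disc] by blast
  moreover have "uniform_limit (cball z d) f g sequentially"
    using assms(1) d compact_cball unfolding locally_uniform_limit_def by blast
  ultimately show thesis by (rule that)
qed

text \<open>Locally uniform convergence tolerates a moving argument. This is what allows one to pass to the
  limit in the semigroup law \<open>\<omega> s t (\<omega> a s z) = \<omega> a t z\<close>, where the inner value moves
  together with the outer map.\<close>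

lemma locally_uniform_limit_tendsto_along:
  assumes f: "locally_uniform_limit f g" and g: "g holomorphic_on unit_disc"
    and z: "z \<in> unit_disc" "X \<longlonglongrightarrow> z"
  shows "(\<lambda>n. f n (X n)) \<longlonglongrightarrow> g z"
proof -
  obtain d where d: "0 < d" "cball z d \<subseteq> unit_disc" "uniform_limit (cball z d) f g sequentially"
    using locally_uniform_limit_cball[OF f z(1)] .
  have near: "\<forall>\<^sub>F n in sequentially. X n \<in> cball z d"
    using tendstoD[OF z(2) d(1)] by eventually_elim (simp add: dist_commute less_imp_le)
  have "(\<lambda>n. f n (X n) - g (X n)) \<longlonglongrightarrow> 0"
  proof (rule tendstoI)
    fix e :: real assume "0 < e"
    from uniform_limitD[OF d(3) this] near
    show "\<forall>\<^sub>F n in sequentially. dist (f n (X n) - g (X n)) 0 < e"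
      by eventually_elim (simp add: dist_norm)
  qed
  moreover have "isCont g z"
    using g z(1) by (meson continuous_on_eq_continuous_at holomorphic_on_imp_continuous_on open_ball)
  then have "(\<lambda>n. g (X n)) \<longlonglongrightarrow> g z"
    using isCont_tendsto_compose z(2) by blast
  ultimately have "(\<lambda>n. f n (X n) - g (X n) + g (X n)) \<longlonglongrightarrow> 0 + g z"
    by (rule tendsto_add)
  then show ?thesis by simp
qed

lemma locally_uniform_limit_tendsto:
  assumes "locally_uniform_limit f g" "g holomorphic_on unit_disc" "z \<in> unit_disc"
  shows "(\<lambda>n. f n z) \<longlonglongrightarrow> g z"
  using locally_uniform_limit_tendsto_along[OF assms tendsto_const] .

lemma locally_uniform_limit_tendsto_deriv:
  assumes f: "locally_uniform_limit f g" "\<And>n. f n holomorphic_on unit_disc" and z: "z \<in> unit_disc"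
  shows "(\<lambda>n. deriv (f n) z) \<longlonglongrightarrow> deriv g z"
proof -
  obtain d where d: "0 < d" "cball z d \<subseteq> unit_disc" "uniform_limit (cball z d) f g sequentially"
    using locally_uniform_limit_cball[OF f(1) z] .
  show ?thesis
  proof (rule deriv_complex_uniform_limit[where A = "ball z d"])
    show "uniform_limit (ball z d) f g sequentially"
      by (rule uniform_limit_on_subset[OF d(3) ball_subset_cball])
    show "\<forall>\<^sub>F n in sequentially. f n holomorphic_on ball z d"
      using holomorphic_on_subset[OF f(2) order.trans[OF ball_subset_cball d(2)]] by simp
  qed (use d(1) in auto)
qed

section \<open>Normal families of self-maps of the disc\<close>

lemma self_maps_discD:
  assumes "f \<in> self_maps_disc"
  shows "f holomorphic_on unit_disc" "\<And>z. z \<in> unit_disc \<Longrightarrow> f z \<in> unit_disc"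
  using assms by (auto simp: self_maps_disc_def analytic_disc_def image_subset_iff)

lemma Montel_self_maps:
  assumes "\<And>n::nat. f n \<in> self_maps_disc"
  obtains r h where "strict_mono r" "h holomorphic_on unit_disc" "h ` unit_disc \<subseteq> cball 0 1"
    "locally_uniform_limit (\<lambda>n. f (r n)) h"
proof -
  obtain h r where h: "h holomorphic_on unit_disc" "strict_mono (r :: nat \<Rightarrow> nat)"
      "\<And>x. x \<in> unit_disc \<Longrightarrow> ((\<lambda>n. f (r n) x) \<longlongrightarrow> h x) sequentially"
      "\<And>K. \<lbrakk>compact K; K \<subseteq> unit_disc\<rbrakk> \<Longrightarrow> uniform_limit K (f \<circ> r) h sequentially"
  proof (rule Montel[of unit_disc self_maps_disc f])
    fix K :: "complex set" assume "compact K" "K \<subseteq> unit_disc"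
    then have "\<forall>h\<in>self_maps_disc. \<forall>z\<in>K. norm (h z) \<le> 1"
      using self_maps_discD(2) by (metis less_imp_le mem_ball_0 subsetD)
    then show "\<exists>B. \<forall>h\<in>self_maps_disc. \<forall>z\<in>K. norm (h z) \<le> B" ..
  qed (use assms self_maps_discD in auto)
  have "h z \<in> cball 0 1" if "z \<in> unit_disc" for z
  proof (rule Lim_in_closed_set[OF closed_cball _ _ h(3)[OF that]])
    show "\<forall>\<^sub>F n in sequentially. f (r n) z \<in> cball 0 1"
      using self_maps_discD(2)[OF assms that] by (intro always_eventually) (simp add: less_imp_le)
  qed simp
  then have "h ` unit_disc \<subseteq> cball 0 1" by blast
  then show thesis
    by (intro that[OF h(2,1)]) (use h(4) in \<open>auto simp: locally_uniform_limit_def o_def\<close>)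
qed

text \<open>A limit of self-maps can only reach the unit circle by being constant (maximum modulus); one
  interior value rules this out.\<close>

lemma holomorphic_into_cball_imp_self_map:
  assumes h: "h holomorphic_on unit_disc" "h ` unit_disc \<subseteq> cball 0 1"
    and z0: "z0 \<in> unit_disc" "h z0 \<in> unit_disc"
  shows "h \<in> self_maps_disc"
proof -
  have "h z \<in> unit_disc" if z: "z \<in> unit_disc" for z
  proof (rule ccontr)
    assume nz: "h z \<notin> unit_disc"
    have "norm (h x) \<le> norm (h z)" if "x \<in> unit_disc" for x
      using h(2) that nz by (meson image_subset_iff linorder_not_le mem_ball_0 mem_cball_0 order.trans less_imp_le)
    then have "h constant_on unit_disc"
      using maximum_modulus_principle[OF h(1) open_ball connected_ball open_ball subset_refl z] by blast
    then show False
      using nz z0 z by (metis constant_on_def)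
  qed
  then show ?thesis
    using h(1) by (auto simp: self_maps_disc_def analytic_disc_def)
qed

text \<open>If convergence failed on a compact set, some subsequence would stay a fixed distance away there.
  By Montel's theorem a further subsequence converges locally uniformly, and its limit is forced to
  be \<open>g\<close> by the pointwise hypothesis. Thus convergence in the space of analytic functions
  reduces to pointwise statements along subsequences of one's choice.\<close>

lemma locally_uniform_limit_if_subseq_pointwise:
  assumes f: "\<And>n. f n \<in> self_maps_disc"
    and sub: "\<And>r :: nat \<Rightarrow> nat. strict_mono r \<Longrightarrow>
      \<exists>q :: nat \<Rightarrow> nat. strict_mono q \<and> (\<forall>z\<in>unit_disc. (\<lambda>n. f (r (q n)) z) \<longlonglongrightarrow> g z)"
  shows "locally_uniform_limit f g"
proof (rule ccontr)
  assume "\<not> locally_uniform_limit f g"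
  then obtain K e where K: "compact K" "K \<subseteq> unit_disc" and e: "0 < e"
    and inf: "\<not> (\<forall>\<^sub>F n in sequentially. \<forall>z\<in>K. dist (f n z) (g z) < e)"
    by (auto simp: locally_uniform_limit_def uniform_limit_iff)
  from inf have "\<exists>\<^sub>F n in sequentially. \<not> (\<forall>z\<in>K. dist (f n z) (g z) < e)"
    by (simp add: frequently_def)
  then have "infinite {n. \<not> (\<forall>z\<in>K. dist (f n z) (g z) < e)}"
    by (simp add: frequently_cofinite flip: cofinite_eq_sequentially)
  then obtain r :: "nat \<Rightarrow> nat" where r: "strict_mono r"
    and far: "\<And>n. \<not> (\<forall>z\<in>K. dist (f (r n) z) (g z) < e)"
    using infinite_enumerate by blast
  obtain q where q: "strict_mono q" "\<And>z. z \<in> unit_disc \<Longrightarrow> (\<lambda>n. f (r (q n)) z) \<longlonglongrightarrow> g z"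
    using sub[OF r] by blast
  obtain p h where p: "strict_mono p" "h holomorphic_on unit_disc"
      "locally_uniform_limit (\<lambda>n. f (r (q (p n)))) h"
    using Montel_self_maps[of "\<lambda>n. f (r (q n))"] f by metis
  have hg: "h z = g z" if "z \<in> unit_disc" for z
    using LIMSEQ_unique[OF locally_uniform_limit_tendsto[OF p(3,2) that]]
      LIMSEQ_subseq_LIMSEQ[OF q(2)[OF that] p(1)] by (simp add: o_def)
  have "\<forall>\<^sub>F n in sequentially. \<forall>z\<in>K. dist (f (r (q (p n))) z) (h z) < e"
    using p(3) K e by (auto simp: locally_uniform_limit_def uniform_limit_iff)
  then have "\<forall>\<^sub>F n in sequentially. False"
    by eventually_elim (use far hg K(2) in \<open>metis subsetD\<close>)
  then show False by simp
qed

text \<open>Sequences suffice because the parameter space is first countable and limits in the target are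
  tested on one compact set at a time.\<close>

lemma continuous_map_loc_unif_iff_sequentially:
  fixes F :: "'a::first_countable_topology \<Rightarrow> complex \<Rightarrow> complex"
  assumes F: "\<And>x. x \<in> S \<Longrightarrow> F x \<in> analytic_disc"
  shows "continuous_map (top_of_set S) loc_unif_topology F \<longleftrightarrow>
    (\<forall>x\<in>S. \<forall>X. (\<forall>n. X n \<in> S) \<and> X \<longlonglongrightarrow> x \<longrightarrow> locally_uniform_limit (\<lambda>n. F (X n)) (F x))"
    (is "?lhs \<longleftrightarrow> ?rhs")
proof -
  have ev: "\<forall>\<^sub>F y in at x within S. F y \<in> analytic_disc" for x
    using F by (auto simp: eventually_at_filter)
  have atin: "atin_within euclidean x S = at x within S" for x :: 'a
    by (simp add: atin_within_def at_within_def nhdsin_def nhds_def)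
  have "?lhs \<longleftrightarrow> (\<forall>x\<in>S. limitin loc_unif_topology F (F x) (at x within S))"
    by (simp add: continuous_map_atin atin_subtopology_within atin)
  also have "\<dots> \<longleftrightarrow> (\<forall>x\<in>S. \<forall>K. compact K \<and> K \<subseteq> unit_disc \<longrightarrow> uniform_limit K F (F x) (at x within S))"
    using limitin_loc_unif_topology[OF ev F] by simp
  also have "\<dots> \<longleftrightarrow> ?rhs"
  proof safe
    fix x X
    assume lim: "\<forall>x\<in>S. \<forall>K. compact K \<and> K \<subseteq> unit_disc \<longrightarrow> uniform_limit K F (F x) (at x within S)"
      and x: "x \<in> S" and X: "\<forall>n. X n \<in> S" "X \<longlonglongrightarrow> x"
    show "locally_uniform_limit (\<lambda>n. F (X n)) (F x)"
      unfolding locally_uniform_limit_def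
    proof (intro allI impI uniform_limitI)
      fix K :: "complex set" and e :: real
      assume K: "compact K \<and> K \<subseteq> unit_disc" and e: "0 < e"
      then have "\<forall>\<^sub>F y in at x within S. \<forall>z\<in>K. dist (F y z) (F x z) < e"
        using lim x by (auto simp: uniform_limit_iff)
      then have "\<forall>\<^sub>F y in nhds x. y \<noteq> x \<longrightarrow> y \<in> S \<longrightarrow> (\<forall>z\<in>K. dist (F y z) (F x z) < e)"
        by (simp add: eventually_at_filter)
      then have "\<forall>\<^sub>F n in sequentially. X n \<noteq> x \<longrightarrow> X n \<in> S \<longrightarrow> (\<forall>z\<in>K. dist (F (X n) z) (F x z) < e)"
        using X(2) by (rule eventually_compose_filterlim)
      then show "\<forall>\<^sub>F n in sequentially. \<forall>z\<in>K. dist (F (X n) z) (F x z) < e"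
        by eventually_elim (use X(1) e in \<open>metis dist_self\<close>)
    qed
  next
    fix x K
    assume rhs: ?rhs and x: "x \<in> S" and K: "compact K" "K \<subseteq> unit_disc"
    show "uniform_limit K F (F x) (at x within S)"
    proof (intro uniform_limitI sequentially_imp_eventually_within allI impI)
      fix e :: real and X
      assume "0 < e" "(\<forall>n. X n \<in> S \<and> X n \<noteq> x) \<and> X \<longlonglongrightarrow> x"
      then show "\<forall>\<^sub>F n in sequentially. \<forall>z\<in>K. dist (F (X n) z) (F x z) < e"
        using rhs x K by (auto simp: locally_uniform_limit_def uniform_limit_iff)
    qed
  qed
  finally show ?thesis .
qed

section \<open>Rigidity at an interior fixed point\<close>

text \<open>The equality case of the Schwarz lemma. Conjugating by a disc automorphism moves the fixed point
  to \<open>0\<close> and does not change the derivative there, so the conjugate is a rotation with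
  derivative \<open>1\<close>, that is, the identity.\<close>

lemma self_map_deriv_one_at_fixed_point_imp_id:
  assumes k: "k \<in> self_maps_disc" and w: "w \<in> unit_disc" and fp: "k w = w" and der: "deriv k w = 1"
    and z: "z \<in> unit_disc"
  shows "k z = z"
proof -
  define \<phi> \<psi> where "\<phi> = Moebius_function 0 w" and "\<psi> = Moebius_function 0 (- w)"
  have nw: "norm w < 1" using w by simp
  have hol: "\<phi> holomorphic_on unit_disc" "\<psi> holomorphic_on unit_disc"
    using Moebius_function_holomorphic nw by (auto simp: \<phi>_def \<psi>_def)
  have into: "\<phi> x \<in> unit_disc" "\<psi> x \<in> unit_disc" if "x \<in> unit_disc" for x
    using Moebius_function_norm_lt_1 nw that by (auto simp: \<phi>_def \<psi>_def)
  have inv: "\<phi> (\<psi> x) = x" "\<psi> (\<phi> x) = x" if "x \<in> unit_disc" for x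
    using Moebius_function_compose[of w "-w" x] Moebius_function_compose[of "-w" w x] nw that
    by (auto simp: \<phi>_def \<psi>_def)
  have \<phi>w: "\<phi> w = 0" by (simp add: \<phi>_def Moebius_function_eq_zero)
  have \<psi>0: "\<psi> 0 = w" by (simp add: \<psi>_def Moebius_function_of_zero)
  note kD = self_maps_discD[OF k]
  have der_at: "(f has_field_derivative deriv f x) (at x)" if "f holomorphic_on unit_disc" "x \<in> unit_disc" for f x
    using holomorphic_derivI[OF that(1) open_ball that(2)] by simp
  define F where "F = (\<lambda>x. \<phi> (k (\<psi> x)))"
  have F_hol: "F holomorphic_on unit_disc"
    unfolding F_def
    using holomorphic_on_compose_gen[OF holomorphic_on_compose_gen[OF hol(2) kD(1)] hol(1)] into kD(2)
    by (force simp: o_def image_subset_iff)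
  have "((\<lambda>x. \<phi> (\<psi> x)) has_field_derivative deriv \<phi> w * deriv \<psi> 0) (at 0)"
    by (intro DERIV_chain2[of \<phi>] der_at hol) (use der_at[OF hol(1) w] \<psi>0 in auto)
  then have "((\<lambda>x. x) has_field_derivative deriv \<phi> w * deriv \<psi> 0) (at 0)"
    by (rule has_field_derivative_transform_within_open[where S = unit_disc]) (use inv in auto)
  then have one: "deriv \<phi> w * deriv \<psi> 0 = 1"
    using DERIV_unique DERIV_ident by blast
  have "(F has_field_derivative deriv \<phi> w * (deriv k w * deriv \<psi> 0)) (at 0)"
    unfolding F_def
    by (intro DERIV_chain2[of \<phi>] DERIV_chain2[of k])
       (use der_at[OF hol(1) w] der_at[OF kD(1) w] der_at[OF hol(2)] \<psi>0 fp in auto)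
  then have dF: "deriv F 0 = 1"
    using one der by (simp add: DERIV_imp_deriv)
  have F0: "F 0 = 0" by (simp add: F_def \<psi>0 fp \<phi>w)
  have F_lt: "norm (F x) < 1" if "norm x < 1" for x
    using into kD(2) that by (auto simp: F_def)
  obtain \<alpha> where \<alpha>: "\<forall>x. norm x < 1 \<longrightarrow> F x = \<alpha> * x"
    using Schwarz_Lemma(3)[OF F_hol F0 F_lt, of 0] dF by auto
  have "deriv F 0 = \<alpha>"
  proof (rule DERIV_imp_deriv)
    have "((\<lambda>x. \<alpha> * x) has_field_derivative \<alpha>) (at 0)"
      by (auto intro!: derivative_eq_intros)
    then show "(F has_field_derivative \<alpha>) (at 0)"
      by (rule has_field_derivative_transform_within_open[where S = unit_disc]) (use \<alpha> in auto)
  qed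
  then have "F (\<phi> z) = \<phi> z"
    using \<alpha> dF into(1)[OF z] by auto
  then have "\<phi> (k z) = \<phi> z" using inv(2)[OF z] by (simp add: F_def)
  then show "k z = z" using inv(2) kD(2) z by metis
qed

section \<open>Evolution families along sequences of times\<close>

lemma evolution_family_self_map:
  "\<lbrakk>evolution_family I \<omega>; s \<in> I; t \<in> I; s \<le> t\<rbrakk> \<Longrightarrow> \<omega> s t \<in> self_maps_disc"
  by (auto simp: evolution_family_def ordered_pairs_def)

lemma evolution_family_nonconstant:
  "\<lbrakk>evolution_family I \<omega>; s \<in> I; t \<in> I; s \<le> t\<rbrakk> \<Longrightarrow> \<not> \<omega> s t constant_on unit_disc"
  by (auto simp: evolution_family_def ordered_pairs_def)

lemma evolution_family_identity:
  "\<lbrakk>evolution_family I \<omega>; t \<in> I; z \<in> unit_disc\<rbrakk> \<Longrightarrow> \<omega> t t z = z"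
  by (auto simp: evolution_family_def)

lemma evolution_family_compose:
  "\<lbrakk>evolution_family I \<omega>; s \<in> I; u \<in> I; t \<in> I; s \<le> u; u \<le> t; z \<in> unit_disc\<rbrakk>
    \<Longrightarrow> \<omega> u t (\<omega> s u z) = \<omega> s t z"
  by (auto simp: evolution_family_def)

lemma evolution_family_subset:
  assumes "evolution_family I \<omega>" "J \<subseteq> I"
  shows "evolution_family J \<omega>"
  using assms(1) subsetD[OF assms(2)]
  unfolding evolution_family_def ordered_pairs_def by blast

lemma deriv_compose_disc:
  assumes f: "f \<in> self_maps_disc" and g: "g \<in> self_maps_disc"
    and h: "\<And>z. z \<in> unit_disc \<Longrightarrow> h z = g (f z)" and z: "z \<in> unit_disc"
  shows "deriv h z = deriv g (f z) * deriv f z"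
proof (rule DERIV_imp_deriv)
  have der_at: "(f has_field_derivative deriv f x) (at x)"
    if "f \<in> self_maps_disc" "x \<in> unit_disc" for f x
    using holomorphic_derivI[OF self_maps_discD(1)[OF that(1)] open_ball that(2)] by simp
  have "((\<lambda>z. g (f z)) has_field_derivative deriv g (f z) * deriv f z) (at z)"
    by (intro DERIV_chain2[of g] der_at f g self_maps_discD(2)[OF f] z)
  then show "(h has_field_derivative deriv g (f z) * deriv f z) (at z)"
    by (rule has_field_derivative_transform_within_open[where S = unit_disc]) (use h z in auto)
qed

lemma subsequential_limit_self_map:
  assumes f: "\<And>n. f n \<in> self_maps_disc" and h: "h holomorphic_on unit_disc" "h ` unit_disc \<subseteq> cball 0 1"
    and lim: "locally_uniform_limit f h" and z: "z \<in> unit_disc"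
    and v: "(\<lambda>n. f n z) \<longlonglongrightarrow> v" "v \<in> unit_disc" and d: "(\<lambda>n. deriv (f n) z) \<longlonglongrightarrow> d"
  shows "h \<in> self_maps_disc" "h z = v" "deriv h z = d"
proof -
  show "h z = v"
    using LIMSEQ_unique[OF locally_uniform_limit_tendsto[OF lim h(1) z] v(1)] .
  then show "h \<in> self_maps_disc"
    using holomorphic_into_cball_imp_self_map[OF h z] v(2) by simp
  show "deriv h z = d"
    using LIMSEQ_unique[OF locally_uniform_limit_tendsto_deriv[OF lim self_maps_discD(1)[OF f] z] d] .
qed

text \<open>Let \<open>s n \<le> t n\<close> be two sequences of times with the same limit \<open>u\<close>.
  Montel's theorem, applied to \<open>\<omega> a (s n)\<close>, \<open>\<omega> a (t n)\<close> and
  \<open>\<omega> (s n) (t n)\<close>, gives limits \<open>g\<close>, \<open>h\<close> and \<open>k\<close> along a common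
  subsequence, and the semigroup law becomes \<open>h = k \<circ> g\<close>. The continuity assumption at the
  base point \<open>z0\<close> says that \<open>g\<close> and \<open>h\<close> have the same value and the same
  derivative at \<open>z0\<close>. Since the common value lies inside the disc, all three limits are
  genuine self-maps.\<close>

lemma evolution_subsequential_limits:
  assumes ev: "evolution_family {a..b} \<omega>" and z0: "z0 \<in> unit_disc"
    and cv: "continuous_on {a..b} (\<lambda>t. \<omega> a t z0)"
    and cd: "continuous_on {a..b} (\<lambda>t. deriv (\<omega> a t) z0)"
    and s: "\<And>n. s n \<in> {a..b}" "s \<longlonglongrightarrow> u" and t: "\<And>n. t n \<in> {a..b}" "t \<longlonglongrightarrow> u"
    and st: "\<And>n. s n \<le> t n" and u: "u \<in> {a..b}"
  obtains q g h k where "strict_mono (q :: nat \<Rightarrow> nat)"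
    "locally_uniform_limit (\<lambda>n. \<omega> a (s (q n))) g" "locally_uniform_limit (\<lambda>n. \<omega> a (t (q n))) h"
    "g \<in> self_maps_disc" "h \<in> self_maps_disc" "k \<in> self_maps_disc"
    "g z0 = \<omega> a u z0" "h z0 = \<omega> a u z0"
    "deriv g z0 = deriv (\<omega> a u) z0" "deriv h z0 = deriv (\<omega> a u) z0"
    "\<And>z. z \<in> unit_disc \<Longrightarrow> h z = k (g z)"
proof -
  have a: "a \<in> {a..b}" using u by auto
  have self: "\<omega> a x \<in> self_maps_disc" if "x \<in> {a..b}" for x
    using evolution_family_self_map[OF ev a that] that by simp
  have self': "\<omega> (s n) (t n) \<in> self_maps_disc" for n
    using evolution_family_self_map[OF ev s(1) t(1) st] .
  obtain r1 g where g: "strict_mono r1" "g holomorphic_on unit_disc" "g ` unit_disc \<subseteq> cball 0 1"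
      "locally_uniform_limit (\<lambda>n. \<omega> a (s (r1 n))) g"
    using Montel_self_maps[of "\<lambda>n. \<omega> a (s n)"] self s(1) by metis
  obtain r2 h where h: "strict_mono r2" "h holomorphic_on unit_disc" "h ` unit_disc \<subseteq> cball 0 1"
      "locally_uniform_limit (\<lambda>n. \<omega> a (t (r1 (r2 n)))) h"
    using Montel_self_maps[of "\<lambda>n. \<omega> a (t (r1 n))"] self t(1) by metis
  obtain r3 k where k: "strict_mono r3" "k holomorphic_on unit_disc" "k ` unit_disc \<subseteq> cball 0 1"
      "locally_uniform_limit (\<lambda>n. \<omega> (s (r1 (r2 (r3 n)))) (t (r1 (r2 (r3 n))))) k"
    using Montel_self_maps[of "\<lambda>n. \<omega> (s (r1 (r2 n))) (t (r1 (r2 n)))"] self' by metis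
  \<comment> \<open>The three extractions are nested, so all limits exist along their composition.\<close>
  define q where "q = (\<lambda>n. r1 (r2 (r3 n)))"
  have q: "strict_mono q"
    using g(1) h(1) k(1) by (simp add: q_def strict_mono_def)
  have lim_g: "locally_uniform_limit (\<lambda>n. \<omega> a (s (q n))) g"
    using locally_uniform_limit_subseq[OF locally_uniform_limit_subseq[OF g(4) h(1)] k(1)]
    by (simp add: q_def)
  have lim_h: "locally_uniform_limit (\<lambda>n. \<omega> a (t (q n))) h"
    using locally_uniform_limit_subseq[OF h(4) k(1)] by (simp add: q_def)
  have lim_k: "locally_uniform_limit (\<lambda>n. \<omega> (s (q n)) (t (q n))) k"
    using k(4) by (simp add: q_def)
  have sq: "(\<lambda>n. s (q n)) \<longlonglongrightarrow> u" and tq: "(\<lambda>n. t (q n)) \<longlonglongrightarrow> u"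
    using LIMSEQ_subseq_LIMSEQ[OF s(2) q] LIMSEQ_subseq_LIMSEQ[OF t(2) q] by (auto simp: o_def)
  have w: "\<omega> a u z0 \<in> unit_disc"
    using self_maps_discD(2)[OF self[OF u] z0] .
  note g' = subsequential_limit_self_map[OF self[OF s(1)] g(2,3) lim_g z0
      continuous_on_tendsto_compose[OF cv sq u always_eventually[OF allI[OF s(1)]]] w
      continuous_on_tendsto_compose[OF cd sq u always_eventually[OF allI[OF s(1)]]]]
  note h' = subsequential_limit_self_map[OF self[OF t(1)] h(2,3) lim_h z0
      continuous_on_tendsto_compose[OF cv tq u always_eventually[OF allI[OF t(1)]]] w
      continuous_on_tendsto_compose[OF cd tq u always_eventually[OF allI[OF t(1)]]]]
  have hkg: "h z = k (g z)" if z: "z \<in> unit_disc" for z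
  proof -
    have "(\<lambda>n. \<omega> (s (q n)) (t (q n)) (\<omega> a (s (q n)) z)) \<longlonglongrightarrow> k (g z)"
      by (rule locally_uniform_limit_tendsto_along[OF lim_k k(2) self_maps_discD(2)[OF g'(1) z]
            locally_uniform_limit_tendsto[OF lim_g g(2) z]])
    moreover have "\<omega> (s n) (t n) (\<omega> a (s n) z) = \<omega> a (t n) z" for n
      using evolution_family_compose[OF ev a s(1) t(1) _ st z] s(1) by simp
    ultimately have "(\<lambda>n. \<omega> a (t (q n)) z) \<longlonglongrightarrow> k (g z)" by simp
    then show ?thesis
      using LIMSEQ_unique[OF locally_uniform_limit_tendsto[OF lim_h h(2) z]] by blast
  qed
  have "k (\<omega> a u z0) \<in> unit_disc"
    using hkg[OF z0] g'(2) h'(2) w by simp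
  then have "k \<in> self_maps_disc"
    using holomorphic_into_cball_imp_self_map[OF k(2,3) w] by simp
  then show thesis
    using that[OF q lim_g lim_h g'(1) h'(1) _ g'(2) h'(2) g'(3) h'(3) hkg] by blast
qed

lemma jointly_continuous_iff_sequentially:
  assumes "evolution_family I \<omega>"
  shows "jointly_continuous I \<omega> \<longleftrightarrow>
    (\<forall>S T s t. (\<forall>n. (S n, T n) \<in> ordered_pairs I) \<and> (s, t) \<in> ordered_pairs I \<and>
      S \<longlonglongrightarrow> s \<and> T \<longlonglongrightarrow> t \<longrightarrow> locally_uniform_limit (\<lambda>n. \<omega> (S n) (T n)) (\<omega> s t))"
    (is "_ \<longleftrightarrow> ?rhs")
proof -
  have analytic: "(case x of (s, t) \<Rightarrow> \<omega> s t) \<in> analytic_disc" if "x \<in> ordered_pairs I" for x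
    using that evolution_family_self_map[OF assms]
    by (auto simp: ordered_pairs_def self_maps_disc_def)
  have "jointly_continuous I \<omega> \<longleftrightarrow> (\<forall>x\<in>ordered_pairs I. \<forall>X. (\<forall>n. X n \<in> ordered_pairs I) \<and> X \<longlonglongrightarrow> x
      \<longrightarrow> locally_uniform_limit (\<lambda>n. case X n of (s, t) \<Rightarrow> \<omega> s t) (case x of (s, t) \<Rightarrow> \<omega> s t))"
    unfolding jointly_continuous_def using analytic
    by (rule continuous_map_loc_unif_iff_sequentially)
  also have "\<dots> \<longleftrightarrow> ?rhs"
  proof safe
    fix S T s t
    assume "\<forall>x\<in>ordered_pairs I. \<forall>X. (\<forall>n. X n \<in> ordered_pairs I) \<and> X \<longlonglongrightarrow> x
        \<longrightarrow> locally_uniform_limit (\<lambda>n. case X n of (s, t) \<Rightarrow> \<omega> s t) (case x of (s, t) \<Rightarrow> \<omega> s t)"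
      and "\<forall>n. (S n, T n) \<in> ordered_pairs I" "(s, t) \<in> ordered_pairs I" "S \<longlonglongrightarrow> s" "T \<longlonglongrightarrow> t"
    from this(1)[rule_format, of "(s, t)" "\<lambda>n. (S n, T n)"] this(2-)
    show "locally_uniform_limit (\<lambda>n. \<omega> (S n) (T n)) (\<omega> s t)"
      by (simp add: tendsto_Pair)
  next
    fix s t X
    assume rhs: ?rhs
      and X: "(s, t) \<in> ordered_pairs I" "\<forall>n. X n \<in> ordered_pairs I" "X \<longlonglongrightarrow> (s, t)"
    from X(3) have "(\<lambda>n. fst (X n)) \<longlonglongrightarrow> s" "(\<lambda>n. snd (X n)) \<longlonglongrightarrow> t"
      using tendsto_fst tendsto_snd by fastforce+
    with rhs[rule_format, of "\<lambda>n. fst (X n)" "\<lambda>n. snd (X n)" s t] X(1,2)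
    show "locally_uniform_limit (\<lambda>n. case X n of (s, t) \<Rightarrow> \<omega> s t) (\<omega> s t)"
      by (simp add: case_prod_beta)
  qed
  finally show ?thesis .
qed

lemma continuous_right_parameter_iff_sequentially:
  assumes "evolution_family {a..b} \<omega>"
  shows "continuous_right_parameter a b \<omega> \<longleftrightarrow>
    (\<forall>u\<in>{a..b}. \<forall>T. (\<forall>n. T n \<in> {a..b}) \<and> T \<longlonglongrightarrow> u
      \<longrightarrow> locally_uniform_limit (\<lambda>n. \<omega> a (T n)) (\<omega> a u))"
  unfolding continuous_right_parameter_def
  by (rule continuous_map_loc_unif_iff_sequentially)
     (use evolution_family_self_map[OF assms, of a] in \<open>auto simp: self_maps_disc_def\<close>)

section \<open>From one base point to continuity in the right parameter\<close>

text \<open>With \<open>s n\<close> and \<open>t n\<close> the minimum and the maximum of \<open>T n\<close> and \<open>u\<close>,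
  one factorization covers approach from both sides. In \<open>h = k \<circ> g\<close> the map \<open>k\<close>
  fixes the common value at \<open>z0\<close>, and because the common derivative is nonzero the chain rule
  yields derivative \<open>1\<close> for \<open>k\<close> there. Hence \<open>k\<close> is the identity and
  \<open>\<omega> a (s n)\<close> and \<open>\<omega> a (t n)\<close> have the same limit. These two maps are
  \<open>\<omega> a (T n)\<close> and \<open>\<omega> a u\<close> in some order, so the difference of the latter tends
  to zero.\<close>

lemma evolution_continuous_at_regular_time:
  assumes ev: "evolution_family {a..b} \<omega>" and z0: "z0 \<in> unit_disc"
    and cv: "continuous_on {a..b} (\<lambda>t. \<omega> a t z0)"
    and cd: "continuous_on {a..b} (\<lambda>t. deriv (\<omega> a t) z0)"
    and u: "u \<in> {a..b}" and reg: "deriv (\<omega> a u) z0 \<noteq> 0"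
    and T: "\<And>n. T n \<in> {a..b}" "T \<longlonglongrightarrow> u"
  shows "locally_uniform_limit (\<lambda>n. \<omega> a (T n)) (\<omega> a u)"
proof (rule locally_uniform_limit_if_subseq_pointwise)
  have a: "a \<in> {a..b}" using u by auto
  show "\<omega> a (T n) \<in> self_maps_disc" for n
    using evolution_family_self_map[OF ev a T(1)] T(1) by simp
  fix r :: "nat \<Rightarrow> nat" assume r: "strict_mono r"
  define s t where "s = (\<lambda>n. min (T (r n)) u)" and "t = (\<lambda>n. max (T (r n)) u)"
  have Tr: "(\<lambda>n. T (r n)) \<longlonglongrightarrow> u"
    using LIMSEQ_subseq_LIMSEQ[OF T(2) r] by (simp add: o_def)
  have s: "s n \<in> {a..b}" "s \<longlonglongrightarrow> u" and t: "t n \<in> {a..b}" "t \<longlonglongrightarrow> u" and st: "s n \<le> t n" for n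
    using T(1)[of "r n"] u tendsto_min[OF Tr tendsto_const[of u]] tendsto_max[OF Tr tendsto_const[of u]]
    by (auto simp: s_def t_def)
  obtain q g h k where q: "strict_mono (q :: nat \<Rightarrow> nat)"
    and lim: "locally_uniform_limit (\<lambda>n. \<omega> a (s (q n))) g" "locally_uniform_limit (\<lambda>n. \<omega> a (t (q n))) h"
    and self: "g \<in> self_maps_disc" "h \<in> self_maps_disc" "k \<in> self_maps_disc"
    and val: "g z0 = \<omega> a u z0" "h z0 = \<omega> a u z0"
    and der: "deriv g z0 = deriv (\<omega> a u) z0" "deriv h z0 = deriv (\<omega> a u) z0"
    and hkg: "\<And>z. z \<in> unit_disc \<Longrightarrow> h z = k (g z)"
    by (rule evolution_subsequential_limits[OF ev z0 cv cd s t st u]) blast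
  have "deriv h z0 = deriv k (g z0) * deriv g z0"
    by (rule deriv_compose_disc[OF self(1,3) hkg z0])
  then have "deriv k (g z0) = 1"
    using der reg by simp
  moreover have "k (g z0) = g z0"
    using hkg[OF z0] val by simp
  ultimately have k_id: "k z = z" if "z \<in> unit_disc" for z
    using self_map_deriv_one_at_fixed_point_imp_id[OF self(3) self_maps_discD(2)[OF self(1) z0]] that by blast
  have "(\<lambda>n. \<omega> a (T (r (q n))) z) \<longlonglongrightarrow> \<omega> a u z" if z: "z \<in> unit_disc" for z
  proof -
    have "h z = g z"
      using hkg[OF z] k_id[OF self_maps_discD(2)[OF self(1) z]] by simp
    then have "(\<lambda>n. \<omega> a (t (q n)) z - \<omega> a (s (q n)) z) \<longlonglongrightarrow> 0"
      using tendsto_diff[OF locally_uniform_limit_tendsto[OF lim(2) self_maps_discD(1)[OF self(2)] z]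
        locally_uniform_limit_tendsto[OF lim(1) self_maps_discD(1)[OF self(1)] z]] by simp
    then have "(\<lambda>n. \<omega> a (T (r (q n))) z - \<omega> a u z) \<longlonglongrightarrow> 0"
    proof (rule Lim_transform_bound[rotated])
      have "norm (\<omega> a (T (r n)) z - \<omega> a u z) = norm (\<omega> a (t n) z - \<omega> a (s n) z)" for n
        by (cases "T (r n) \<le> u") (simp_all add: s_def t_def norm_minus_commute)
      then show "\<forall>\<^sub>F n in sequentially. norm (\<omega> a (T (r (q n))) z - \<omega> a u z)
          \<le> norm (\<omega> a (t (q n)) z - \<omega> a (s (q n)) z)" by simp
    qed
    then show ?thesis by (simp add: LIM_zero_iff)
  qed
  then show "\<exists>q :: nat \<Rightarrow> nat. strict_mono q \<and>
      (\<forall>z\<in>unit_disc. (\<lambda>n. \<omega> a (T (r (q n))) z) \<longlonglongrightarrow> \<omega> a u z)"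
    using q by blast
qed

section \<open>From the right parameter to joint continuity\<close>

text \<open>Let \<open>h\<close> be a subsequential limit of \<open>\<omega> (S n) (T n)\<close>. Passing to the limit in
  the semigroup law gives \<open>h \<circ> \<omega> a s = \<omega> a t = \<omega> s t \<circ> \<omega> a s\<close>,
  so \<open>h\<close> and \<open>\<omega> s t\<close> agree on the image of \<open>\<omega> a s\<close>. That image is
  open because \<open>\<omega> a s\<close> is not constant, and the identity theorem finishes the proof.\<close>

lemma continuous_right_parameter_imp_jointly_continuous:
  assumes ev: "evolution_family {a..b} \<omega>"
    and "continuous_right_parameter a b \<omega>"
  shows "jointly_continuous {a..b} \<omega>"
  unfolding jointly_continuous_iff_sequentially[OF ev]
proof (intro allI impI, elim conjE, rule locally_uniform_limit_if_subseq_pointwise)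
  fix S T s t
  assume "\<forall>n. (S n, T n) \<in> ordered_pairs {a..b}" "(s, t) \<in> ordered_pairs {a..b}"
    and lims: "S \<longlonglongrightarrow> s" "T \<longlonglongrightarrow> t"
  then have s: "S n \<in> {a..b}" "S \<longlonglongrightarrow> s" and t: "T n \<in> {a..b}" "T \<longlonglongrightarrow> t" and ST: "S n \<le> T n"
    and I: "s \<in> {a..b}" "t \<in> {a..b}" "s \<le> t" for n
    by (auto simp: ordered_pairs_def)
  have rc: "locally_uniform_limit (\<lambda>n. \<omega> a (T n)) (\<omega> a u)"
    if "u \<in> {a..b}" "\<And>n. T n \<in> {a..b}" "T \<longlonglongrightarrow> u" for u T
    using assms(2) that unfolding continuous_right_parameter_iff_sequentially[OF ev] by blast
  have a: "a \<in> {a..b}" using I by auto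
  have self: "\<omega> a x \<in> self_maps_disc" if "x \<in> {a..b}" for x
    using evolution_family_self_map[OF ev a that] that by simp
  note self_st = evolution_family_self_map[OF ev I]
  show self_ST: "\<omega> (S n) (T n) \<in> self_maps_disc" for n
    using evolution_family_self_map[OF ev s(1) t(1) ST] .
  fix r :: "nat \<Rightarrow> nat" assume r: "strict_mono r"
  obtain q h where q: "strict_mono q" and h: "h holomorphic_on unit_disc"
    and lim: "locally_uniform_limit (\<lambda>n. \<omega> (S (r (q n))) (T (r (q n)))) h"
    using Montel_self_maps[of "\<lambda>n. \<omega> (S (r n)) (T (r n))"] self_ST by metis
  have rq: "strict_mono (\<lambda>n. r (q n))"
    using r q by (simp add: strict_mono_def)
  have Sr: "(\<lambda>n. S (r (q n))) \<longlonglongrightarrow> s" and Tr: "(\<lambda>n. T (r (q n))) \<longlonglongrightarrow> t"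
    using LIMSEQ_subseq_LIMSEQ[OF s(2) rq] LIMSEQ_subseq_LIMSEQ[OF t(2) rq] by (auto simp: o_def)
  have eq: "h y = \<omega> s t y" if "y \<in> \<omega> a s ` unit_disc" for y
  proof -
    obtain z where z: "z \<in> unit_disc" "y = \<omega> a s z" using \<open>y \<in> _\<close> by blast
    have "(\<lambda>n. \<omega> a (S (r (q n))) z) \<longlonglongrightarrow> \<omega> a s z"
      using locally_uniform_limit_tendsto[OF rc[OF I(1) s(1) Sr] self_maps_discD(1)[OF self[OF I(1)]] z(1)] .
    then have "(\<lambda>n. \<omega> (S (r (q n))) (T (r (q n))) (\<omega> a (S (r (q n))) z)) \<longlonglongrightarrow> h y"
      using locally_uniform_limit_tendsto_along[OF lim h self_maps_discD(2)[OF self[OF I(1)] z(1)]] z(2)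
      by simp
    moreover have "\<omega> (S n) (T n) (\<omega> a (S n) z) = \<omega> a (T n) z" for n
      using evolution_family_compose[OF ev a s(1) t(1) _ ST z(1)] s(1) by simp
    ultimately have "(\<lambda>n. \<omega> a (T (r (q n))) z) \<longlonglongrightarrow> h y" by simp
    moreover have "(\<lambda>n. \<omega> a (T (r (q n))) z) \<longlonglongrightarrow> \<omega> a t z"
      using locally_uniform_limit_tendsto[OF rc[OF I(2) t(1) Tr] self_maps_discD(1)[OF self[OF I(2)]] z(1)] .
    ultimately have "h y = \<omega> a t z" by (rule LIMSEQ_unique)
    also have "\<dots> = \<omega> s t y"
      using evolution_family_compose[OF ev a I(1,2) _ I(3) z(1)] I(1) z(2) by simp
    finally show ?thesis .
  qed
  have "open (\<omega> a s ` unit_disc)"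
    using open_mapping_thm[OF self_maps_discD(1)[OF self[OF I(1)]] open_ball connected_ball open_ball subset_refl]
      evolution_family_nonconstant[OF ev a I(1)] I(1) by simp
  moreover have "\<omega> a s ` unit_disc \<subseteq> unit_disc"
    using self_maps_discD(2)[OF self[OF I(1)]] by blast
  ultimately have "h z = \<omega> s t z" if "z \<in> unit_disc" for z
    using analytic_continuation_open[OF _ open_ball _ connected_ball _ h self_maps_discD(1)[OF self_st] eq that]
    by auto
  then show "\<exists>q :: nat \<Rightarrow> nat. strict_mono q \<and>
      (\<forall>z\<in>unit_disc. (\<lambda>n. \<omega> (S (r (q n))) (T (r (q n))) z) \<longlonglongrightarrow> \<omega> s t z)"
    using q locally_uniform_limit_tendsto[OF lim h] by metis
qed

section \<open>Univalence\<close>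

text \<open>By Cauchy's inequality the derivative of \<open>\<lambda>z. f z - z\<close> is at most \<open>1/2\<close> on the
  smaller ball, so \<open>f\<close> is a perturbation of the identity by a contraction.\<close>

lemma near_identity_inj_on:
  fixes f :: "complex \<Rightarrow> complex"
  assumes f: "f holomorphic_on ball p r" and near: "\<And>z. z \<in> ball p r \<Longrightarrow> norm (f z - z) < r / 4"
  shows "inj_on f (ball p (r / 2))"
proof (rule inj_onI)
  fix x y assume xy: "x \<in> ball p (r / 2)" "y \<in> ball p (r / 2)" "f x = f y"
  define g where "g = (\<lambda>z. f z - z)"
  have g: "g holomorphic_on ball p r"
    unfolding g_def by (intro holomorphic_intros f)
  have r: "0 < r" using xy(1) by (metis ball_eq_empty empty_iff half_gt_zero_iff linorder_not_le)
  have "norm (g x - g y) \<le> (1 / 2) * norm (x - y)"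
  proof (rule field_differentiable_bound[OF convex_ball, of p "r / 2" g "deriv g"])
    fix z assume z: "z \<in> ball p (r / 2)"
    have sub: "cball z (r / 2) \<subseteq> ball p r"
    proof
      fix x assume "x \<in> cball z (r / 2)"
      then show "x \<in> ball p r"
        using z dist_triangle[of p x z] by auto
    qed
    show "(g has_field_derivative deriv g z) (at z within ball p (r / 2))"
      using holomorphic_derivI[OF g open_ball] sub r
      by (meson centre_in_cball has_field_derivative_at_within half_gt_zero less_imp_le subsetD)
    have "norm ((deriv ^^ 1) g z) \<le> fact 1 * (r / 4) / (r / 2) ^ 1"
    proof (rule Cauchy_inequality)
      show "g holomorphic_on ball z (r / 2)"
        using holomorphic_on_subset[OF g order.trans[OF ball_subset_cball sub]] .
      show "continuous_on (cball z (r / 2)) g"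
        using holomorphic_on_imp_continuous_on[OF holomorphic_on_subset[OF g sub]] .
      fix x assume "norm (z - x) = r / 2"
      then have "x \<in> ball p r"
        using sub by (auto simp: dist_norm)
      then show "norm (g x) \<le> r / 4"
        using near by (simp add: g_def less_imp_le)
    qed (use r in simp)
    then show "norm (deriv g z) \<le> 1 / 2"
      using r by simp
  qed (use xy in auto)
  moreover have "norm (g x - g y) = norm (x - y)"
    using xy(3) by (simp add: g_def norm_minus_commute)
  ultimately show "x = y" by simp
qed

lemma approach_from_below:
  fixes a u :: real
  assumes "a < u"
  obtains v where "\<And>n. a \<le> v n" "\<And>n. v n < u" "v \<longlonglongrightarrow> u"
proof
  define v where "v = (\<lambda>n. u - (u - a) * inverse (real (Suc n)))"
  have "inverse (real (Suc n)) \<le> 1" for n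
    by (simp add: field_simps)
  then have "(u - a) * inverse (real (Suc n)) \<le> (u - a) * 1" for n
    using assms by (intro mult_left_mono) auto
  then show "a \<le> v n" for n
    by (simp add: v_def le_diff_eq add.commute)
  show "v n < u" for n
    using assms by (simp add: v_def)
  have "v \<longlonglongrightarrow> u - (u - a) * 0"
    unfolding v_def by (intro tendsto_intros LIMSEQ_inverse_real_of_nat)
  then show "v \<longlonglongrightarrow> u" by simp
qed

lemma first_zero:
  fixes f :: "real \<Rightarrow> 'a :: {t1_space, zero}"
  assumes "continuous_on {a..b} f" "t \<in> {a..b}" "f t = 0" "f a \<noteq> 0"
  obtains u where "a < u" "u \<le> b" "f u = 0" "\<And>v. a \<le> v \<Longrightarrow> v < u \<Longrightarrow> f v \<noteq> 0"
proof -
  define C where "C = {x \<in> {a..b}. f x = 0}"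
  have "closed C"
    unfolding C_def by (rule continuous_closed_preimage_constant[OF assms(1) closed_atLeastAtMost])
  moreover have bdd: "bdd_below C" and "C \<noteq> {}"
    using assms(2,3) by (auto simp: C_def)
  ultimately have u: "Inf C \<in> C"
    by (intro closed_contains_Inf)
  show thesis
  proof
    show "a < Inf C" "Inf C \<le> b" "f (Inf C) = 0"
      using u assms(4) by (auto simp: C_def less_le)
    fix v assume "a \<le> v" "v < Inf C"
    then show "f v \<noteq> 0"
      using cInf_lower[OF _ bdd, of v] u by (auto simp: C_def)
  qed
qed

text \<open>Suppose that the trajectories of two distinct points collide, for the first time at \<open>u\<close>.
  Shortly before \<open>u\<close> they are at distinct points near the collision point, and
  \<open>\<omega> v u\<close> still identifies them although it is close to the identity and therefore injective
  near the collision point.\<close>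

lemma jointly_continuous_imp_injective:
  assumes ev: "evolution_family I \<omega>" and jc: "jointly_continuous I \<omega>"
    and st: "s \<le> t" "{s..t} \<subseteq> I"
  shows "inj_on (\<omega> s t) unit_disc"
proof (rule inj_onI, rule ccontr)
  fix z1 z2 assume z: "z1 \<in> unit_disc" "z2 \<in> unit_disc" "\<omega> s t z1 = \<omega> s t z2" "z1 \<noteq> z2"
  have sI: "s \<in> I" using st by auto
  have inI: "x \<in> I" if "s \<le> x" "x \<le> t" for x
    using st(2) that by auto
  have self: "\<omega> x y \<in> self_maps_disc" if "s \<le> x" "x \<le> y" "y \<le> t" for x y
    using evolution_family_self_map[OF ev inI inI] that by simp
  have lim: "locally_uniform_limit (\<lambda>n. \<omega> (X n) (Y n)) (\<omega> x y)"
    if "\<And>n. s \<le> X n" "\<And>n. X n \<le> Y n" "\<And>n. Y n \<le> t" "s \<le> x" "x \<le> y" "y \<le> t" "X \<longlonglongrightarrow> x" "Y \<longlonglongrightarrow> y"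
    for X Y x y
  proof -
    have "(X n, Y n) \<in> ordered_pairs I" for n
      using inI[OF that(1) order.trans[OF that(2,3)]] inI[OF order.trans[OF that(1,2)] that(3)] that(2)
      by (simp add: ordered_pairs_def)
    moreover have "(x, y) \<in> ordered_pairs I"
      using inI[OF that(4) order.trans[OF that(5,6)]] inI[OF order.trans[OF that(4,5)] that(6)] that(5)
      by (simp add: ordered_pairs_def)
    ultimately show ?thesis
      using jc that(7,8) unfolding jointly_continuous_iff_sequentially[OF ev] by blast
  qed
  have cont: "continuous_on {s..t} (\<lambda>u. \<omega> s u z)" if "z \<in> unit_disc" for z
    unfolding continuous_on_sequentially
  proof (intro allI ballI impI, elim conjE)
    fix X u assume X: "u \<in> {s..t}" "\<forall>n. X n \<in> {s..t}" "X \<longlonglongrightarrow> u"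
    have "locally_uniform_limit (\<lambda>n. \<omega> s (X n)) (\<omega> s u)"
      using X by (intro lim) auto
    then show "((\<lambda>u. \<omega> s u z) \<circ> X) \<longlonglongrightarrow> \<omega> s u z"
      unfolding o_def
      using X(1) by (intro locally_uniform_limit_tendsto self_maps_discD(1) self that) auto
  qed
  have "continuous_on {s..t} (\<lambda>u. \<omega> s u z1 - \<omega> s u z2)"
    by (intro continuous_on_diff cont z)
  moreover have "t \<in> {s..t}" using st(1) by simp
  moreover have "\<omega> s s z1 - \<omega> s s z2 \<noteq> 0"
    using evolution_family_identity[OF ev sI] z by simp
  ultimately obtain u where u: "s < u" "u \<le> t" "\<omega> s u z1 - \<omega> s u z2 = 0"
    and before: "\<And>v. s \<le> v \<Longrightarrow> v < u \<Longrightarrow> \<omega> s v z1 - \<omega> s v z2 \<noteq> 0"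
    using z(3) first_zero[of s t "\<lambda>u. \<omega> s u z1 - \<omega> s u z2" t] by auto
  obtain v where v: "\<And>n. s \<le> v n" "\<And>n. v n < u" "v \<longlonglongrightarrow> u"
    by (rule approach_from_below[OF u(1)]) blast
  define p where "p = \<omega> s u z1"
  have p: "p \<in> unit_disc"
    unfolding p_def by (rule self_maps_discD(2)[OF self z(1)]) (use u in auto)
  have "locally_uniform_limit (\<lambda>n. \<omega> (v n) u) (\<omega> u u)"
    using u(1,2) v less_imp_le[OF v(2)] by (intro lim) auto
  then obtain r where r: "0 < r" "cball p r \<subseteq> unit_disc"
    and unif: "uniform_limit (cball p r) (\<lambda>n. \<omega> (v n) u) (\<omega> u u) sequentially"
    using locally_uniform_limit_cball p by blast
  have conv: "(\<lambda>n. \<omega> s (v n) z) \<longlonglongrightarrow> \<omega> s u z" if "z \<in> unit_disc" for z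
    by (rule continuous_on_tendsto_compose[OF cont[OF that] v(3)])
       (use u v(1) less_imp_le[OF order.strict_trans2[OF v(2) u(2)]] in auto)
  have "(\<lambda>n. \<omega> s (v n) z1) \<longlonglongrightarrow> p" "(\<lambda>n. \<omega> s (v n) z2) \<longlonglongrightarrow> p"
    using conv[OF z(1)] conv[OF z(2)] u(3) by (simp_all add: p_def)
  then have "\<forall>\<^sub>F n in sequentially. dist (\<omega> s (v n) z1) p < r / 2"
    "\<forall>\<^sub>F n in sequentially. dist (\<omega> s (v n) z2) p < r / 2"
    using tendstoD half_gt_zero[OF r(1)] by blast+
  moreover have "\<forall>\<^sub>F n in sequentially. \<forall>z\<in>cball p r. dist (\<omega> (v n) u z) (\<omega> u u z) < r / 4"
    by (rule uniform_limitD[OF unif]) (use r(1) in simp)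
  ultimately have "\<forall>\<^sub>F n in sequentially. (dist (\<omega> s (v n) z1) p < r / 2 \<and>
      dist (\<omega> s (v n) z2) p < r / 2) \<and> (\<forall>z\<in>cball p r. dist (\<omega> (v n) u z) (\<omega> u u z) < r / 4)"
    by (intro eventually_conj)
  from eventually_happens'[OF sequentially_bot this]
  obtain n where n: "dist (\<omega> s (v n) z1) p < r / 2" "dist (\<omega> s (v n) z2) p < r / 2"
      "\<forall>z\<in>cball p r. dist (\<omega> (v n) u z) (\<omega> u u z) < r / 4"
    by blast
  have uI: "u \<in> I" and vI: "v n \<in> I"
    using inI[of u] inI[of "v n"] u(1,2) v(1)[of n] v(2)[of n] by auto
  have "inj_on (\<omega> (v n) u) (ball p (r / 2))"
  proof (rule near_identity_inj_on)
    show "\<omega> (v n) u holomorphic_on ball p r"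
      using self_maps_discD(1)[OF self] holomorphic_on_subset[OF _ order.trans[OF ball_subset_cball r(2)]]
        u(2) v(1)[of n] v(2)[of n] by simp
    fix z assume "z \<in> ball p r"
    then have z: "z \<in> cball p r" by simp
    have "\<omega> u u z = z"
      using evolution_family_identity[OF ev uI subsetD[OF r(2) z]] .
    then show "norm (\<omega> (v n) u z - z) < r / 4"
      using bspec[OF n(3) z] by (simp add: dist_norm)
  qed
  moreover have "\<omega> (v n) u (\<omega> s (v n) z1) = \<omega> (v n) u (\<omega> s (v n) z2)"
    using evolution_family_compose[OF ev sI vI uI v(1) less_imp_le[OF v(2)]] z(1,2) u(3) by simp
  moreover have "\<omega> s (v n) z1 \<in> ball p (r / 2)" "\<omega> s (v n) z2 \<in> ball p (r / 2)"
    using n(1,2) by (simp_all add: dist_commute)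
  ultimately have "\<omega> s (v n) z1 = \<omega> s (v n) z2"
    by (rule inj_onD)
  then show False
    using before[OF v(1) v(2)] by simp
qed

section \<open>The derivative never vanishes\<close>

lemma deriv_nonzero_imp_continuous_right_parameter:
  assumes ev: "evolution_family {a..b} \<omega>" and z0: "z0 \<in> unit_disc"
    and cv: "continuous_on {a..b} (\<lambda>t. \<omega> a t z0)"
    and cd: "continuous_on {a..b} (\<lambda>t. deriv (\<omega> a t) z0)"
    and reg: "\<And>u. u \<in> {a..b} \<Longrightarrow> deriv (\<omega> a u) z0 \<noteq> 0"
  shows "continuous_right_parameter a b \<omega>"
  unfolding continuous_right_parameter_iff_sequentially[OF ev]
proof (intro ballI allI impI, elim conjE)
  fix u T assume u: "u \<in> {a..b}" and T: "\<forall>n. T n \<in> {a..b}" "T \<longlonglongrightarrow> u"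
  show "locally_uniform_limit (\<lambda>n. \<omega> a (T n)) (\<omega> a u)"
    by (rule evolution_continuous_at_regular_time[OF ev z0 cv cd u reg[OF u] _ T(2)]) (use T(1) in blast)
qed

text \<open>Let \<open>u\<close> be the first zero of the derivative. On every shorter interval \<open>{a..v}\<close> with
  \<open>v < u\<close> the derivative has no zero, so the family is jointly continuous there and
  \<open>\<omega> a v\<close> is injective. A limit \<open>g\<close> of such maps as \<open>v\<close> increases to
  \<open>u\<close> has derivative \<open>0\<close> at \<open>z0\<close> and so is not injective; by Hurwitz's theorem
  it is constant. But \<open>\<omega> a u = k \<circ> g\<close> for some \<open>k\<close>, contradicting that
  \<open>\<omega> a u\<close> is not constant. This is where non-constancy of the family excludes a collapse
  at \<open>u\<close>.\<close>

lemma evolution_deriv_nonzero: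
  assumes ev: "evolution_family {a..b} \<omega>" and z0: "z0 \<in> unit_disc"
    and cv: "continuous_on {a..b} (\<lambda>t. \<omega> a t z0)"
    and cd: "continuous_on {a..b} (\<lambda>t. deriv (\<omega> a t) z0)"
    and t: "t \<in> {a..b}"
  shows "deriv (\<omega> a t) z0 \<noteq> 0"
proof
  assume "deriv (\<omega> a t) z0 = 0"
  have a: "a \<in> {a..b}" using t by auto
  have "((\<lambda>z. z) has_field_derivative 1) (at z0)" by (rule DERIV_ident)
  then have "(\<omega> a a has_field_derivative 1) (at z0)"
    by (rule has_field_derivative_transform_within_open[where S = unit_disc])
       (use evolution_family_identity[OF ev a] z0 in auto)
  then have "deriv (\<omega> a a) z0 \<noteq> 0"
    by (simp add: DERIV_imp_deriv)
  then obtain u where u: "a < u" "u \<le> b" "deriv (\<omega> a u) z0 = 0"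
    and before: "\<And>v. a \<le> v \<Longrightarrow> v < u \<Longrightarrow> deriv (\<omega> a v) z0 \<noteq> 0"
    using first_zero[OF cd t \<open>deriv (\<omega> a t) z0 = 0\<close>] by metis
  obtain v where v: "\<And>n. a \<le> v n" "\<And>n. v n < u" "v \<longlonglongrightarrow> u"
    by (rule approach_from_below[OF u(1)]) blast
  have uI: "u \<in> {a..b}" and vI: "v n \<in> {a..b}" and vu: "v n \<le> u" for n
    using u v(1,2)[of n] by auto
  have inj: "inj_on (\<omega> a (v n)) unit_disc" for n
  proof -
    have sub: "{a..v n} \<subseteq> {a..b}" using vI[of n] by auto
    have ev': "evolution_family {a..v n} \<omega>"
      using evolution_family_subset[OF ev sub] .
    have "continuous_right_parameter a (v n) \<omega>"
      by (rule deriv_nonzero_imp_continuous_right_parameter[OF ev' z0])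
         (use continuous_on_subset[OF cv sub] continuous_on_subset[OF cd sub] before
            order.strict_trans1[OF _ v(2)] in auto)
    then have "jointly_continuous {a..v n} \<omega>"
      by (rule continuous_right_parameter_imp_jointly_continuous[OF ev'])
    then show ?thesis
      by (rule jointly_continuous_imp_injective[OF ev']) (use v(1) in auto)
  qed
  \<comment> \<open>The upper times are constantly \<open>u\<close>, so \<open>h\<close> is \<open>\<omega> a u\<close> on the disc.\<close>
  obtain q g h k where q: "strict_mono (q :: nat \<Rightarrow> nat)"
    and lim: "locally_uniform_limit (\<lambda>n. \<omega> a (v (q n))) g" "locally_uniform_limit (\<lambda>n. \<omega> a u) h"
    and self: "g \<in> self_maps_disc" "h \<in> self_maps_disc"
    and der: "deriv g z0 = deriv (\<omega> a u) z0"
    and hkg: "\<And>z. z \<in> unit_disc \<Longrightarrow> h z = k (g z)"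
    by (rule evolution_subsequential_limits[OF ev z0 cv cd vI v(3) uI tendsto_const vu uI]) blast
  have "\<not> inj_on g unit_disc"
    using holomorphic_injective_imp_regular[OF self_maps_discD(1)[OF self(1)] open_ball _ z0] der u(3)
    by auto
  then have "g constant_on unit_disc"
    using Hurwitz_injective[OF open_ball connected_ball _ self_maps_discD(1)[OF self(1)], of "\<lambda>n. \<omega> a (v (q n))"]
      self_maps_discD(1)[OF evolution_family_self_map[OF ev a vI v(1)]] lim(1) inj
    unfolding locally_uniform_limit_def by blast
  moreover have "\<omega> a u z = k (g z)" if "z \<in> unit_disc" for z
    using LIMSEQ_unique[OF tendsto_const locally_uniform_limit_tendsto[OF lim(2) self_maps_discD(1)[OF self(2)] that]]
      hkg[OF that] by simp
  ultimately have "\<omega> a u constant_on unit_disc"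
    unfolding constant_on_def by metis
  then show False
    using evolution_family_nonconstant[OF ev a uI less_imp_le[OF u(1)]] by simp
qed

section \<open>The equivalences\<close>

lemma continuous_right_parameter_imp_value_deriv_continuous:
  assumes ev: "evolution_family {a..b} \<omega>" and rc: "continuous_right_parameter a b \<omega>"
    and z: "z \<in> unit_disc"
  shows "continuous_on {a..b} (\<lambda>t. \<omega> a t z)" "continuous_on {a..b} (\<lambda>t. deriv (\<omega> a t) z)"
proof -
  have self: "\<omega> a x \<in> self_maps_disc" if "x \<in> {a..b}" for x
    using evolution_family_self_map[OF ev _ that] that by simp
  have lim: "locally_uniform_limit (\<lambda>n. \<omega> a (X n)) (\<omega> a u)"
    if "\<forall>n. X n \<in> {a..b}" "X \<longlonglongrightarrow> u" "u \<in> {a..b}" for X u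
    using rc that unfolding continuous_right_parameter_iff_sequentially[OF ev] by blast
  show "continuous_on {a..b} (\<lambda>t. \<omega> a t z)"
    unfolding continuous_on_sequentially o_def
    using locally_uniform_limit_tendsto[OF lim self_maps_discD(1)[OF self] z] by blast
  show "continuous_on {a..b} (\<lambda>t. deriv (\<omega> a t) z)"
    unfolding continuous_on_sequentially o_def
    using locally_uniform_limit_tendsto_deriv[OF lim self_maps_discD(1)[OF self] z] by blast
qed

lemma jointly_continuous_imp_continuous_right_parameter:
  assumes ev: "evolution_family {a..b} \<omega>" and jc: "jointly_continuous {a..b} \<omega>"
  shows "continuous_right_parameter a b \<omega>"
  unfolding continuous_right_parameter_iff_sequentially[OF ev]
proof (intro ballI allI impI, elim conjE)
  fix u T assume T: "u \<in> {a..b}" "\<forall>n. T n \<in> {a..b}" "T \<longlonglongrightarrow> u"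
  have "(\<forall>n. (a, T n) \<in> ordered_pairs {a..b}) \<and> (a, u) \<in> ordered_pairs {a..b} \<and>
      (\<lambda>_::nat. a) \<longlonglongrightarrow> a \<and> T \<longlonglongrightarrow> u"
    using T by (auto simp: ordered_pairs_def)
  then show "locally_uniform_limit (\<lambda>n. \<omega> a (T n)) (\<omega> a u)"
    using jc[unfolded jointly_continuous_iff_sequentially[OF ev], rule_format, of "\<lambda>_. a" T a u]
    by blast
qed

theorem theorem1p6:
  fixes a b :: real and \<omega> :: "real \<Rightarrow> real \<Rightarrow> complex \<Rightarrow> complex"
  assumes "a < b"
    and "evolution_family {a..b} \<omega>"
  shows "(jointly_continuous {a..b} \<omega> \<longleftrightarrow> continuous_right_parameter a b \<omega>) \<and>
    (continuous_right_parameter a b \<omega> \<longleftrightarrow>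
       (\<forall>z0\<in>unit_disc. continuous_on {a..b} (\<lambda>t. \<omega> a t z0) \<and>
                        continuous_on {a..b} (\<lambda>t. deriv (\<omega> a t) z0))) \<and>
    ((\<forall>z0\<in>unit_disc. continuous_on {a..b} (\<lambda>t. \<omega> a t z0) \<and>
                       continuous_on {a..b} (\<lambda>t. deriv (\<omega> a t) z0)) \<longleftrightarrow>
       (\<exists>z0\<in>unit_disc. continuous_on {a..b} (\<lambda>t. \<omega> a t z0) \<and>
                        continuous_on {a..b} (\<lambda>t. deriv (\<omega> a t) z0))) \<and>
    (jointly_continuous {a..b} \<omega> \<longrightarrow>
       (\<forall>(s, t)\<in>ordered_pairs {a..b}. inj_on (\<omega> s t) unit_disc))"
    (is "(?i \<longleftrightarrow> ?ii) \<and> (?ii \<longleftrightarrow> ?iii) \<and> (?iii \<longleftrightarrow> ?iv) \<and> (?i \<longrightarrow> ?univalent)")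
proof -
  note ev = assms(2)
  have "?ii" if "?i"
    using jointly_continuous_imp_continuous_right_parameter[OF ev that] .
  moreover have "?i" if "?ii"
    using continuous_right_parameter_imp_jointly_continuous[OF ev that] .
  moreover have "?iii" if "?ii"
    using continuous_right_parameter_imp_value_deriv_continuous[OF ev that] by blast
  moreover have "?iv" if "?iii"
    using that centre_in_ball[of "0::complex" 1] by (metis zero_less_one)
  moreover have "?ii" if "?iv"
    using that deriv_nonzero_imp_continuous_right_parameter[OF ev] evolution_deriv_nonzero[OF ev] by blast
  moreover have "?univalent" if "?i"
  proof clarify
    fix s t assume "(s, t) \<in> ordered_pairs {a..b}"
    then show "inj_on (\<omega> s t) unit_disc"
      by (intro jointly_continuous_imp_injective[OF ev that]) (auto simp: ordered_pairs_def)
  qed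
  ultimately show ?thesis by blast
qed

end
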